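(* Let $X$ be a real normed space with $\dim X\ge 2$, let $1<p<\infty$ and let $q$ be conjugate to $p$, i.e. $1/p+1/q=1$. Let $\lambda\in\Lambda_m$ satisfy the translation condition $$\lambda(a,b)+t\le\lambda(a+t,b+t)\qquad(a,b\ge0,\ -\min\{a,b,1\}\le t\le0).$$ Then $$\mathfrak{C}_{\lambda,p}(X)\le\left[1+\left(2^{1/p}\,\mathfrak{C}'_{\lambda,p}(X)-1\right)^q\right]^{1/q}.$$ Consequently, $$\mathfrak{C}_{\lambda,p}(X)-\mathfrak{C}'_{\lambda,p}(X)\le\left[1+(\sqrt2-1)^q\right]^{1/q}-2^{1/2-1/p}.$$
   Context: $\Lambda$ is the class of all continuous functions $\lambda:[0,\infty)^2\to[0,\infty)$ that are homogeneous of degree one and satisfy $\lambda(1,1)=1$. $\Lambda_m$ is the set of $\lambda\in\Lambda$ that are non-decreasing in each variable. $S_X$ is the unit sphere of $X$ and $\|(r,s)\|_p=(|r|^p+|s|^p)^{1/p}$. Define $$\mathfrak{C}_{\lambda,p}(X)=\sup\{\lambda(\|ru+sv\|,\|su-rv\|):u,v\in S_X,\ r,s\ge0,\ \|(r,s)\|_p=1\},$$ $$\mathfrak{C}'_{\lambda,p}(X)=\sup\{2^{-1/p}\lambda(\|u+v\|,\|u-v\|):u,v\in S_X\}.$$ *)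

theory Defs
  imports "HOL-Analysis.Analysis"
begin

text \<open>
  A function on the closed quadrant is represented by a function on all of \<open>real \<times> real\<close>;
  its values outside \<open>{0..} \<times> {0..}\<close> are unconstrained and never used.
\<close>

definition Lambda :: "(real \<times> real \<Rightarrow> real) set" where
  "Lambda = {lam.
     lam \<in> {0..} \<times> {0..} \<rightarrow> {0..} \<and>
     continuous_on ({0..} \<times> {0..}) lam \<and>
     (\<forall>a\<ge>0. \<forall>b\<ge>0. \<forall>t\<ge>0. lam (t * a, t * b) = t * lam (a, b)) \<and>
     lam (1, 1) = 1}"

definition Lambda_m :: "(real \<times> real \<Rightarrow> real) set" where
  "Lambda_m = {lam \<in> Lambda.
     (\<forall>b\<ge>0. mono_on {0..} (\<lambda>a. lam (a, b))) \<and>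
     (\<forall>a\<ge>0. mono_on {0..} (\<lambda>b. lam (a, b)))}"

definition lp_norm :: "real \<Rightarrow> real \<times> real \<Rightarrow> real" where
  "lp_norm p = (\<lambda>(r, s). (\<bar>r\<bar> powr p + \<bar>s\<bar> powr p) powr (1 / p))"

text \<open>
  The space \<open>X\<close> is the type \<open>'a\<close>. For \<open>lam \<in> Lambda\<close>, \<open>p \<ge> 1\<close> and \<open>X\<close> nontrivial the sets below
  are nonempty and bounded above (the norms involved lie in \<open>{0..2}\<close> and \<open>lam\<close> is continuous
  there), so the real-valued \<open>Sup\<close> is the true supremum.
\<close>

definition C_const ::
    "(real \<times> real \<Rightarrow> real) \<Rightarrow> real \<Rightarrow> 'a::real_normed_vector itself \<Rightarrow> real" where
  "C_const lam p _ =
     Sup {lam (norm (r *\<^sub>R u + s *\<^sub>R v), norm (s *\<^sub>R u - r *\<^sub>R v)) | (u::'a) v r s.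
            u \<in> sphere 0 1 \<and> v \<in> sphere 0 1 \<and> r \<ge> 0 \<and> s \<ge> 0 \<and> lp_norm p (r, s) = 1}"

definition C'_const ::
    "(real \<times> real \<Rightarrow> real) \<Rightarrow> real \<Rightarrow> 'a::real_normed_vector itself \<Rightarrow> real" where
  "C'_const lam p _ =
     Sup {2 powr (- 1 / p) * lam (norm (u + v), norm (u - v)) | (u::'a) v.
            u \<in> sphere 0 1 \<and> v \<in> sphere 0 1}"

end

theory Submission
  imports Defs
begin

text \<open>
  Write \<open>M = 2\<^sup>1\<^sup>/\<^sup>p C'\<close>, the supremum of \<open>\<lambda>(\<parallel>u + v\<parallel>, \<parallel>u - v\<parallel>)\<close>. For \<open>s \<le> r\<close> the triangle
  inequality bounds both arguments of \<open>\<lambda>\<close> in the definition of \<open>C\<close> by \<open>s \<parallel>u \<plusminus> v\<parallel> + (r - s)\<close>;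
  monotonicity, the translation condition with \<open>t = -(r - s)\<close> and homogeneity then give the
  bound \<open>s M + (r - s) = r + s (M - 1)\<close>, and Holder's inequality finishes the first claim.
  The function \<open>M \<mapsto> (1 + (M - 1)\<^sup>q)\<^sup>1\<^sup>/\<^sup>q - 2\<^sup>-\<^sup>1\<^sup>/\<^sup>p M\<close> is non-increasing on \<open>(1, 2]\<close>, so the second claim
  follows from \<open>\<surd>2 \<le> M \<le> 2\<close>. For the lower bound, choose unit vectors with
  \<open>\<parallel>u + v\<parallel> = \<parallel>u - v\<parallel> = a\<close>; the unit vectors \<open>(u \<plusminus> v) / a\<close> form another such pair,
  with \<open>2 / a\<close> in place of \<open>a\<close>, and one of \<open>a\<close>, \<open>2 / a\<close> is at least \<open>\<surd>2\<close>.
\<close>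

section \<open>Real inequalities for conjugate exponents\<close>

lemma conjugate_exponent_gt_1:
  fixes p q :: real
  assumes "1 < p" "1 / p + 1 / q = 1"
  shows "1 < q"
proof -
  have "0 < 1 / p" "1 / p < 1" using assms by auto
  then have "0 < 1 / q" "1 / q < 1" using assms by linarith+
  then show ?thesis by (simp add: field_simps split: if_splits)
qed

text \<open>Dividing by the right-hand side \<open>N\<close> makes \<open>(1 / N, m / N)\<close> a
  unit vector for the exponent \<open>q\<close>; Young's inequality in each coordinate then sums to
  \<open>1 / p + 1 / q = 1\<close>.\<close>

lemma Holder_one_pair:
  fixes p q r s m :: real
  assumes p: "1 < p" and pq: "1 / p + 1 / q = 1"
    and "0 \<le> r" "0 \<le> s" "0 \<le> m" and rs: "r powr p + s powr p = 1"
  shows "r + s * m \<le> (1 + m powr q) powr (1 / q)"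
proof -
  define N where "N = (1 + m powr q) powr (1 / q)"
  have q: "q > 1" using p pq by (rule conjugate_exponent_gt_1)
  have pos: "1 + m powr q > 0" by (smt (verit) powr_ge_zero)
  then have N: "N > 0" and Nq: "N powr q = 1 + m powr q"
    using q by (simp_all add: N_def powr_powr)
  have "r * (1 / N) \<le> r powr p / p + (1 / N) powr q / q"
    by (rule Youngs_inequality) (use assms q N in auto)
  moreover have "s * (m / N) \<le> s powr p / p + (m / N) powr q / q"
    by (rule Youngs_inequality) (use assms q N in auto)
  moreover have "r powr p / p + s powr p / p = 1 / p"
    using rs by (simp add: add_divide_distrib[symmetric])
  moreover have "(1 / N) powr q / q + (m / N) powr q / q = 1 / q"
    using N \<open>0 \<le> m\<close> pos by (simp add: powr_divide Nq add_divide_distrib[symmetric])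
  ultimately have "r * (1 / N) + s * (m / N) \<le> 1" using pq by linarith
  then have "r + s * m \<le> N" using N by (simp add: field_simps)
  then show ?thesis by (simp add: N_def)
qed

text \<open>The derivative is
  \<open>(m powr q / (1 + m powr q)) powr (1 / p) - 2 powr (- 1 / p)\<close>, and the fraction is at
  most \<open>1 / 2\<close> as long as \<open>m \<le> 1\<close>. The variable stands for
  \<open>M - 1\<close>.\<close>

lemma powr_norm_minus_linear_antimono:
  fixes p q x y :: real
  assumes p: "1 < p" and pq: "1 / p + 1 / q = 1" and "0 < x" "x \<le> y" "y \<le> 1"
  shows "(1 + y powr q) powr (1 / q) - 2 powr (- 1 / p) * y
    \<le> (1 + x powr q) powr (1 / q) - 2 powr (- 1 / p) * x"
proof (rule DERIV_nonpos_imp_nonincreasing[OF \<open>x \<le> y\<close>])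
  fix m assume "x \<le> m" "m \<le> y"
  then have m: "0 < m" "m \<le> 1" using assms by auto
  have q: "q > 1" using p pq by (rule conjugate_exponent_gt_1)
  have pos: "1 + m powr q > 0" by (smt (verit) powr_ge_zero)
  let ?D = "1 / q * (1 + m powr q) powr (1 / q - 1) * (q * m powr (q - 1)) - 2 powr (- 1 / p)"
  have "((\<lambda>m. (1 + m powr q) powr (1 / q) - 2 powr (- 1 / p) * m) has_real_derivative ?D) (at m)"
    using m pos q by (auto intro!: derivative_eq_intros)
  moreover have "?D \<le> 0"
  proof -
    \<comment> \<open>Conjugacy gives both exponents a factor \<open>1 / p\<close>, so the two
      powers merge into one.\<close>
    have e: "1 / q - 1 = - 1 / p" "(q - 1) = q * (1 / p)"
      using pq q p by (auto simp: field_simps)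
    have "1 / q * (1 + m powr q) powr (1 / q - 1) * (q * m powr (q - 1))
      = (1 + m powr q) powr (- 1 / p) * (m powr q) powr (1 / p)"
      using q unfolding e by (simp add: powr_powr)
    also have "\<dots> = (m powr q / (1 + m powr q)) powr (1 / p)"
      using pos by (simp add: powr_divide powr_minus_divide)
    also have "\<dots> \<le> (1 / 2) powr (1 / p)"
    proof (rule powr_mono2)
      have "m powr q \<le> 1" using m q by (simp add: powr_le1)
      then show "m powr q / (1 + m powr q) \<le> 1 / 2" using pos by (simp add: field_simps)
    qed (use p pos in auto)
    also have "\<dots> = 2 powr (- 1 / p)" by (simp add: powr_divide powr_minus_divide)
    finally show ?thesis by simp
  qed
  ultimately show "\<exists>D. ((\<lambda>m. (1 + m powr q) powr (1 / q) - 2 powr (- 1 / p) * m)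
      has_real_derivative D) (at m) \<and> D \<le> 0"
    by blast
qed

section \<open>Unit vectors with sum and difference of equal norm\<close>

lemma exists_isosceles_orthogonal_unit_vectors:
  assumes "\<exists>x y :: 'a::real_normed_vector. x \<noteq> y \<and> independent {x, y}"
  obtains u v :: "'a::real_normed_vector" where "norm u = 1" "norm v = 1" "norm (u + v) = norm (u - v)"
proof -
  obtain x y :: 'a where xy: "x \<noteq> y" "independent {x, y}" using assms by blast
  have x0: "x \<noteq> 0" using xy dependent_zero by blast
  \<comment> \<open>A half turn from \<open>x\<close> to \<open>- x\<close> that avoids the origin
    by independence; normalised, it joins \<open>u\<close> to \<open>- u\<close> inside the unit
    sphere.\<close>
  define w where "w t = cos t *\<^sub>R x + sin t *\<^sub>R y" for t
  have w0: "w t \<noteq> 0" for t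
  proof
    assume "w t = 0"
    then have "(\<Sum>z\<in>{x, y}. (if z = x then cos t else sin t) *\<^sub>R z) = 0"
      using xy(1) by (simp add: w_def)
    then have "cos t = 0" "sin t = 0"
      using xy independentD[OF xy(2), of "{x, y}" "\<lambda>z. if z = x then cos t else sin t" x]
        independentD[OF xy(2), of "{x, y}" "\<lambda>z. if z = x then cos t else sin t" y] by auto
    then show False using sin_cos_squared_add[of t] by simp
  qed
  define u where "u = x /\<^sub>R norm x"
  define v where "v t = w t /\<^sub>R norm (w t)" for t
  have u1: "norm u = 1" and v1: "norm (v t) = 1" for t
    using x0 w0 by (simp_all add: u_def v_def)
  \<comment> \<open>\<open>g\<close> falls from \<open>2\<close> at \<open>0\<close> to
    \<open>- 2\<close> at \<open>pi\<close>, so it vanishes at some \<open>t\<close> in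
    between.\<close>
  define g where "g t = norm (u + v t) - norm (u - v t)" for t
  have "continuous_on {0..pi} g"
    using w0 unfolding g_def v_def w_def by (intro continuous_intros) auto
  moreover have "v 0 = u" "v pi = - u" by (simp_all add: v_def u_def w_def)
  then have "g pi \<le> 0" "0 \<le> g 0" by (simp_all add: g_def)
  ultimately obtain t where "g t = 0"
    using IVT2'[of g pi 0 0] by auto
  then show ?thesis using that[of u "v t"] u1 v1 by (simp add: g_def)
qed

lemma exists_unit_vectors_norm_ge_sqrt2:
  assumes "\<exists>x y :: 'a::real_normed_vector. x \<noteq> y \<and> independent {x, y}"
  obtains u v :: "'a::real_normed_vector" where "norm u = 1" "norm v = 1" "norm (u + v) = norm (u - v)"
    "sqrt 2 \<le> norm (u + v)"
proof -
  obtain u v :: 'a where uv: "norm u = 1" "norm v = 1" "norm (u + v) = norm (u - v)"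
    using exists_isosceles_orthogonal_unit_vectors[OF assms] .
  define a where "a = norm (u + v)"
  show ?thesis
  proof (cases "sqrt 2 \<le> a")
    case True
    then show ?thesis using that[of u v] uv by (simp add: a_def)
  next
    case False
    \<comment> \<open>The sum is \<open>2 u\<close>, so \<open>a \<ge> 1\<close> and division by
      \<open>a\<close> is safe.\<close>
    have "2 = norm ((u + v) + (u - v))" using uv by (simp add: scaleR_2[symmetric])
    also have "\<dots> \<le> a + a" using norm_triangle_ineq[of "u + v" "u - v"] uv by (simp add: a_def)
    finally have a: "a > 0" by simp
    define x where "x = (u + v) /\<^sub>R a"
    define y where "y = (u - v) /\<^sub>R a"
    have "x + y = (2 / a) *\<^sub>R u" "x - y = (2 / a) *\<^sub>R v"
      by (simp_all add: x_def y_def algebra_simps scaleR_2[symmetric] divide_inverse)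
    moreover have "norm x = 1" "norm y = 1" using a uv by (simp_all add: x_def y_def a_def)
    moreover have "sqrt 2 \<le> 2 / a"
    proof -
      have "sqrt 2 * a \<le> sqrt 2 * sqrt 2" using False by (intro mult_left_mono) auto
      then show ?thesis using a by (simp add: field_simps)
    qed
    ultimately show ?thesis using that[of x y] uv a by simp
  qed
qed

section \<open>Monotone homogeneous functions and bounds on \<open>C'\<close>\<close>

lemma Lambda_m_mono:
  assumes "lam \<in> Lambda_m" "0 \<le> a" "a \<le> a'" "0 \<le> b" "b \<le> b'"
  shows "lam (a, b) \<le> lam (a', b')"
proof -
  have "mono_on {0..} (\<lambda>a. lam (a, b))" "mono_on {0..} (\<lambda>b. lam (a', b))"
    using assms by (auto simp: Lambda_m_def)
  then have "lam (a, b) \<le> lam (a', b)" "lam (a', b) \<le> lam (a', b')"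
    using assms by (auto simp: mono_on_def)
  then show ?thesis by simp
qed

lemma Lambda_m_homogeneous:
  assumes "lam \<in> Lambda_m" "0 \<le> a" "0 \<le> b" "0 \<le> t"
  shows "lam (t * a, t * b) = t * lam (a, b)"
  using assms by (auto simp: Lambda_m_def Lambda_def)

lemma Lambda_m_diag:
  assumes "lam \<in> Lambda_m" "0 \<le> t"
  shows "lam (t, t) = t"
  using assms Lambda_m_homogeneous[of lam 1 1 t] by (auto simp: Lambda_m_def Lambda_def)

lemma Lambda_m_sphere_le_2:
  fixes u v :: "'a::real_normed_vector"
  assumes "lam \<in> Lambda_m" "norm u = 1" "norm v = 1"
  shows "lam (norm (u + v), norm (u - v)) \<le> 2"
proof -
  have "lam (norm (u + v), norm (u - v)) \<le> lam (2, 2)"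
    using norm_triangle_ineq[of u v] norm_triangle_ineq4[of u v] assms
    by (intro Lambda_m_mono) auto
  then show ?thesis using Lambda_m_diag[of lam 2] assms by simp
qed

lemma C'_const_upper:
  fixes u v :: "'a::real_normed_vector"
  assumes "lam \<in> Lambda_m" "norm u = 1" "norm v = 1"
  shows "lam (norm (u + v), norm (u - v)) \<le> 2 powr (1 / p) * C'_const lam p TYPE('a)"
proof -
  have "2 powr (- 1 / p) * lam (norm (u + v), norm (u - v)) \<le> C'_const lam p TYPE('a)"
    unfolding C'_const_def
  proof (rule cSup_upper)
    show "bdd_above {2 powr (- 1 / p) * lam (norm (u + v), norm (u - v)) |(u::'a) v.
        u \<in> sphere 0 1 \<and> v \<in> sphere 0 1}"
      using Lambda_m_sphere_le_2[OF assms(1)]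
      by (intro bdd_aboveI[of _ "2 powr (- 1 / p) * 2"]) (auto intro!: mult_left_mono)
  qed (use assms in auto)
  then show ?thesis by (simp add: powr_minus field_simps)
qed

text \<open>The unit vector \<open>e\<close> witnesses that the supremum is taken over a nonempty
  set.\<close>

lemma C'_const_le_2:
  assumes "lam \<in> Lambda_m" "norm (e :: 'a::real_normed_vector) = 1"
  shows "2 powr (1 / p) * C'_const lam p TYPE('a) \<le> 2"
proof -
  have "C'_const lam p TYPE('a) \<le> 2 powr (- 1 / p) * 2"
    unfolding C'_const_def using assms Lambda_m_sphere_le_2[OF assms(1)]
    by (intro cSup_least) (auto intro!: mult_left_mono exI[of _ e])
  then show ?thesis by (simp add: powr_minus field_simps)
qed

section \<open>The translation condition applied to rotated pairs\<close>

lemma Lambda_m_combination_le: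
  fixes u v :: "'a::real_normed_vector"
  assumes lam: "lam \<in> Lambda_m"
    and translation: "\<And>a b t. 0 \<le> a \<Longrightarrow> 0 \<le> b \<Longrightarrow> - Min {a, b, 1} \<le> t \<Longrightarrow> t \<le> 0
           \<Longrightarrow> lam (a, b) + t \<le> lam (a + t, b + t)"
    and s: "0 \<le> s" and d: "0 \<le> d" "d \<le> 1"
    and x: "norm x \<le> s * norm (u + v) + d" and y: "norm y \<le> s * norm (u - v) + d"
  shows "lam (norm x, norm y) \<le> s * lam (norm (u + v), norm (u - v)) + d"
proof -
  let ?a = "s * norm (u + v)" and ?b = "s * norm (u - v)"
  have "lam (norm x, norm y) \<le> lam (?a + d, ?b + d)"
    using x y by (intro Lambda_m_mono[OF lam]) auto
  \<comment> \<open>The shift \<open>t = - d\<close> is admissible: both coordinates are at least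
    \<open>d\<close>, and \<open>d \<le> 1\<close>.\<close>
  moreover have "lam (?a + d, ?b + d) + (- d) \<le> lam (?a + d + (- d), ?b + d + (- d))"
    using s d by (intro translation) auto
  moreover have "lam (?a, ?b) = s * lam (norm (u + v), norm (u - v))"
    using s by (intro Lambda_m_homogeneous[OF lam]) auto
  ultimately show ?thesis by simp
qed

text \<open>Splitting \<open>min r s\<close> off both coefficients leaves, up to sign, one unit
  vector of weight \<open>\<bar>r - s\<bar>\<close> in each argument; the order of \<open>r\<close>
  and \<open>s\<close> decides whether it is \<open>u\<close> or \<open>v\<close>. The bounds by
  \<open>1\<close> ensure that this weight is at most \<open>1\<close>.\<close>

lemma Lambda_m_rotated_le:
  fixes u v :: "'a::real_normed_vector"
  assumes lam: "lam \<in> Lambda_m"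
    and translation: "\<And>a b t. 0 \<le> a \<Longrightarrow> 0 \<le> b \<Longrightarrow> - Min {a, b, 1} \<le> t \<Longrightarrow> t \<le> 0
           \<Longrightarrow> lam (a, b) + t \<le> lam (a + t, b + t)"
    and uv: "norm u = 1" "norm v = 1" and rs: "0 \<le> r" "0 \<le> s" "r \<le> 1" "s \<le> 1"
  shows "lam (norm (r *\<^sub>R u + s *\<^sub>R v), norm (s *\<^sub>R u - r *\<^sub>R v))
    \<le> min r s * lam (norm (u + v), norm (u - v)) + \<bar>r - s\<bar>"
proof (cases "s \<le> r")
  case True
  have "r *\<^sub>R u + s *\<^sub>R v = s *\<^sub>R (u + v) + (r - s) *\<^sub>R u"
    "s *\<^sub>R u - r *\<^sub>R v = s *\<^sub>R (u - v) - (r - s) *\<^sub>R v"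
    by (simp_all add: algebra_simps)
  then have "norm (r *\<^sub>R u + s *\<^sub>R v) \<le> s * norm (u + v) + (r - s)"
    "norm (s *\<^sub>R u - r *\<^sub>R v) \<le> s * norm (u - v) + (r - s)"
    using norm_triangle_ineq[of "s *\<^sub>R (u + v)" "(r - s) *\<^sub>R u"]
      norm_triangle_ineq4[of "s *\<^sub>R (u - v)" "(r - s) *\<^sub>R v"] True uv rs by auto
  from Lambda_m_combination_le[OF lam translation _ _ _ this] show ?thesis
    using True rs by simp
next
  case False
  have "r *\<^sub>R u + s *\<^sub>R v = r *\<^sub>R (u + v) + (s - r) *\<^sub>R v"
    "s *\<^sub>R u - r *\<^sub>R v = r *\<^sub>R (u - v) + (s - r) *\<^sub>R u"
    by (simp_all add: algebra_simps)
  then have "norm (r *\<^sub>R u + s *\<^sub>R v) \<le> r * norm (u + v) + (s - r)"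
    "norm (s *\<^sub>R u - r *\<^sub>R v) \<le> r * norm (u - v) + (s - r)"
    using norm_triangle_ineq[of "r *\<^sub>R (u + v)" "(s - r) *\<^sub>R v"]
      norm_triangle_ineq[of "r *\<^sub>R (u - v)" "(s - r) *\<^sub>R u"] False uv rs by auto
  from Lambda_m_combination_le[OF lam translation _ _ _ this] show ?thesis
    using False rs by simp
qed

section \<open>Both inequalities from the bounds on \<open>M\<close>\<close>

theorem theorem18:
  fixes p q :: real and lam :: "real \<times> real \<Rightarrow> real"
  assumes dim_ge_2: "\<exists>x y :: 'a::real_normed_vector. x \<noteq> y \<and> independent {x, y}"
    and "1 < p"
    and "1 / p + 1 / q = 1"
    and "lam \<in> Lambda_m"
    and translation: "\<And>a b t. 0 \<le> a \<Longrightarrow> 0 \<le> b \<Longrightarrow> - Min {a, b, 1} \<le> t \<Longrightarrow> t \<le> 0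
           \<Longrightarrow> lam (a, b) + t \<le> lam (a + t, b + t)"
  shows "C_const lam p TYPE('a)
           \<le> (1 + (2 powr (1 / p) * C'_const lam p TYPE('a) - 1) powr q) powr (1 / q)
       \<and> C_const lam p TYPE('a) - C'_const lam p TYPE('a)
           \<le> (1 + (sqrt 2 - 1) powr q) powr (1 / q) - 2 powr (1 / 2 - 1 / p)"
proof -
  note lam = \<open>lam \<in> Lambda_m\<close>
  define M where "M = 2 powr (1 / p) * C'_const lam p TYPE('a)"
  obtain u0 v0 :: 'a where uv0: "norm u0 = 1" "norm v0 = 1" "norm (u0 + v0) = norm (u0 - v0)"
    "sqrt 2 \<le> norm (u0 + v0)"
    using exists_unit_vectors_norm_ge_sqrt2[OF dim_ge_2] .
  \<comment> \<open>For this pair the arguments of \<open>lam\<close> coincide, and on the diagonal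
    \<open>lam\<close> returns the common value.\<close>
  have M_ge: "sqrt 2 \<le> M"
    using C'_const_upper[OF lam uv0(1,2), of p] uv0 Lambda_m_diag[OF lam, of "norm (u0 + v0)"]
    by (simp add: M_def)
  have M_le: "M \<le> 2" using C'_const_le_2[OF lam uv0(1)] by (simp add: M_def)
  have sqrt2: "sqrt 2 > 1" by simp
  then have "1 \<le> M" using M_ge by linarith
  have C_le: "C_const lam p TYPE('a) \<le> (1 + (M - 1) powr q) powr (1 / q)"
    unfolding C_const_def
  proof (rule cSup_least)
    have "lp_norm p (1, 0) = 1" using \<open>1 < p\<close> by (simp add: lp_norm_def)
    with uv0(1) show "{lam (norm (r *\<^sub>R u + s *\<^sub>R v), norm (s *\<^sub>R u - r *\<^sub>R v)) |(u::'a) v r s.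
        u \<in> sphere 0 1 \<and> v \<in> sphere 0 1 \<and> r \<ge> 0 \<and> s \<ge> 0 \<and> lp_norm p (r, s) = 1} \<noteq> {}"
      by simp (metis order.refl zero_le_one)
  next
    fix z
    assume "z \<in> {lam (norm (r *\<^sub>R u + s *\<^sub>R v), norm (s *\<^sub>R u - r *\<^sub>R v)) |(u::'a) v r s.
        u \<in> sphere 0 1 \<and> v \<in> sphere 0 1 \<and> r \<ge> 0 \<and> s \<ge> 0 \<and> lp_norm p (r, s) = 1}"
    then obtain u v :: 'a and r s where
      z: "z = lam (norm (r *\<^sub>R u + s *\<^sub>R v), norm (s *\<^sub>R u - r *\<^sub>R v))"
      and uv: "norm u = 1" "norm v = 1" and rs: "0 \<le> r" "0 \<le> s"
      and "lp_norm p (r, s) = 1"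
      by auto
    then have "(r powr p + s powr p) powr (1 / p) = 1" by (simp add: lp_norm_def)
    then have "((r powr p + s powr p) powr (1 / p)) powr p = 1" by simp
    then have sum1: "r powr p + s powr p = 1"
      using \<open>1 < p\<close> by (simp add: powr_powr)
    have le1: "x \<le> 1" if "x powr p \<le> 1" for x :: real
      using that \<open>1 < p\<close> by (smt (verit) powr_less_mono2 powr_one_eq_one)
    have "r \<le> 1" "s \<le> 1"
      using sum1 by (smt (verit) le1 powr_ge_zero)+
    then have "z \<le> min r s * lam (norm (u + v), norm (u - v)) + \<bar>r - s\<bar>"
      unfolding z using uv rs by (intro Lambda_m_rotated_le[OF lam translation])
    also have "\<dots> \<le> min r s * M + \<bar>r - s\<bar>"
      using C'_const_upper[OF lam uv, of p] rs
      by (intro add_right_mono mult_left_mono) (auto simp: M_def)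
    \<comment> \<open>Written this way the bound fits \<open>Holder_one_pair\<close> with
      \<open>m = M - 1\<close>, whichever of \<open>r\<close> and \<open>s\<close> is
      larger.\<close>
    also have "\<dots> = max r s + min r s * (M - 1)" by (simp add: min_def max_def algebra_simps)
    also have "\<dots> \<le> (1 + (M - 1) powr q) powr (1 / q)"
      using sum1 rs \<open>1 \<le> M\<close>
      by (intro Holder_one_pair[OF \<open>1 < p\<close> \<open>1 / p + 1 / q = 1\<close>])
         (auto simp: max_def min_def)
    finally show "z \<le> (1 + (M - 1) powr q) powr (1 / q)" .
  qed
  have C': "C'_const lam p TYPE('a) = 2 powr (- 1 / p) * M"
    by (simp add: M_def powr_minus)
  \<comment> \<open>Compares the points \<open>sqrt 2 - 1 \<le> M - 1 \<le> 1\<close>. Using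
    \<open>M - 1\<close> for \<open>M\<close> in the linear term adds
    \<open>2 powr (- 1 / p)\<close> to both sides, which cancels.\<close>
  have "(1 + (M - 1) powr q) powr (1 / q) - 2 powr (- 1 / p) * (M - 1)
    \<le> (1 + (sqrt 2 - 1) powr q) powr (1 / q) - 2 powr (- 1 / p) * (sqrt 2 - 1)"
    using M_ge M_le sqrt2
    by (intro powr_norm_minus_linear_antimono[OF \<open>1 < p\<close> \<open>1 / p + 1 / q = 1\<close>]) auto
  moreover have "2 powr (1 / 2 - 1 / p) = 2 powr (- 1 / p) * sqrt 2"
    by (simp add: powr_half_sqrt[symmetric] powr_add[symmetric])
  ultimately have "C_const lam p TYPE('a) - C'_const lam p TYPE('a)
      \<le> (1 + (sqrt 2 - 1) powr q) powr (1 / q) - 2 powr (1 / 2 - 1 / p)"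
    using C_le unfolding C' by (simp add: algebra_simps)
  then show ?thesis using C_le by (simp add: M_def)
qed

end
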